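(* Let $e_1,e_2,\dots$ be a sequence with $e_i\in\{-1,1\}$, let ${\bf e}(n)=(e_n,\dots,e_2,e_1,e_1,e_2,\dots,e_n)$, let $f_n$ be the Riley polynomial of the kmot group $G({\bf e}(n))$ for $n\ge 1$, and $f_0=1$. Let $\delta_n=e_{n-1}e_n$. Then for all $n>2$, $$f_n=\begin{cases}(\tilde\lambda+1)(f_{n-1}+f_{n-2})-f_{n-3} & \text{when }\delta_n=1,\\ (\lambda-1)(f_{n-1}-f_{n-2})+f_{n-3} & \text{when }\delta_n=-1,\end{cases}$$ that is, $$f_n=\Bigl(\tilde\lambda+\tfrac{\delta_n-1}{2}z^2+\delta_n\Bigr)(f_{n-1}+\delta_nf_{n-2})-\delta_nf_{n-3}.$$
   Context: $M,\lambda$ are indeterminates, $z=M-M^{-1}$, $\tilde\lambda=\lambda+z^2$. For a symmetric sign sequence $\epsilon=(\epsilon_1,\dots,\epsilon_{2n})$ (i.e. $\epsilon_i=\epsilon_{2n+1-i}\in\{1,-1\}$) the kmot group is $G(\epsilon)=\langle x,y\mid wx=yw\rangle$ with $w=x^{\epsilon_1}y^{\epsilon_2}x^{\epsilon_3}y^{\epsilon_4}\cdots x^{\epsilon_{2n-1}}y^{\epsilon_{2n}}$. Let $W$ be the matrix obtained from $w$ by substituting $x\mapsto\begin{pmatrix}M&1\\0&M^{-1}\end{pmatrix}$, $y\mapsto\begin{pmatrix}M&0\\ \lambda&M^{-1}\end{pmatrix}$. The Riley polynomial of $G(\epsilon)$ is $W_{11}-zW_{12}\in\mathbb{Z}[M^{\pm1},\lambda]$.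 *)

theory Defs
  imports
    "HOL-Analysis.Analysis"
    "HOL-Computational_Algebra.Polynomial"
    "HOL-Library.Poly_Mapping"
begin

text \<open>
  The ring of polynomials in \<open>\<lambda>\<close> over the Laurent polynomials in \<open>M\<close> with integer coefficients.
  The latter are the monoid ring of the additive group of integers: \<open>Poly_Mapping.single k c\<close>
  is the monomial \<open>c M\<^sup>k\<close>, with \<open>k\<close> possibly negative.
\<close>

type_synonym laurent_ring = "(int \<Rightarrow>\<^sub>0 int) poly"

definition varM :: laurent_ring
  where "varM = [:Poly_Mapping.single 1 1:]"

definition varM_inv :: laurent_ring
  where "varM_inv = [:Poly_Mapping.single (- 1) 1:]"

definition var_lambda :: laurent_ring
  where "var_lambda = [:0, 1:]"

definition var_z :: laurent_ring
  where "var_z = varM - varM_inv"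

definition lambda_tilde :: laurent_ring
  where "lambda_tilde = var_lambda + var_z\<^sup>2"

lemma varM_mult_varM_inv: "varM * varM_inv = 1" "varM_inv * varM = 1"
  by (simp_all add: varM_def varM_inv_def mult_single)


definition symmetric_signs :: "int list \<Rightarrow> bool"
  where "symmetric_signs eps \<longleftrightarrow> even (length eps) \<and> set eps \<subseteq> {1, - 1} \<and> rev eps = eps"

datatype generator = Gen_x | Gen_y

text \<open>
  A word in the free group on \<open>x\<close>, \<open>y\<close> is a list of letters, each a generator with its exponent
  \<open>1\<close> or \<open>-1\<close>. For a symmetric sign sequence \<open>eps\<close> of length \<open>2n\<close>, \<open>kmot_word eps\<close> is the word
  \<open>w\<close> of the presentation \<open>\<langle>x, y | w x = y w\<rangle>\<close> of the kmot group. As list positions start at \<open>0\<close>,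
  the letters at even positions are powers of \<open>x\<close>. The Riley polynomial is read off from this
  presentation.
\<close>

definition kmot_word :: "int list \<Rightarrow> (generator \<times> int) list"
  where "kmot_word eps =
    map (\<lambda>i. (if even i then Gen_x else Gen_y, eps ! i)) [0..<length eps]"

fun gen_matrix :: "generator \<Rightarrow> laurent_ring^2^2"
  where
    "gen_matrix Gen_x = vector [vector [varM, 1], vector [0, varM_inv]]"
  | "gen_matrix Gen_y = vector [vector [varM, 0], vector [var_lambda, varM_inv]]"

fun letter_matrix :: "generator \<times> int \<Rightarrow> laurent_ring^2^2"
  where "letter_matrix (g, s) = (if s = 1 then gen_matrix g else matrix_inv (gen_matrix g))"

definition word_matrix :: "(generator \<times> int) list \<Rightarrow> laurent_ring^2^2"
  where "word_matrix w = foldr (\<lambda>a A. letter_matrix a ** A) w (mat 1)"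

definition riley_poly :: "int list \<Rightarrow> laurent_ring"
  where "riley_poly eps =
    (let W = word_matrix (kmot_word eps) in W $ 1 $ 1 - var_z * W $ 1 $ 2)"

text \<open>\<open>matrix_inv\<close> is defined by choice; the generator matrices do have inverses over this ring.\<close>

lemma invertible_gen_matrix: "invertible (gen_matrix g)"
proof (cases g)
  case Gen_x
  show ?thesis
    unfolding invertible_def Gen_x
    by (rule exI[of _ "vector [vector [varM_inv, - 1], vector [0, varM]]"])
       (simp add: vec_eq_iff matrix_matrix_mult_def mat_def sum_2 forall_2 varM_mult_varM_inv)
next
  case Gen_y
  show ?thesis
    unfolding invertible_def Gen_y
    by (rule exI[of _ "vector [vector [varM_inv, 0], vector [- var_lambda, varM]]"])
       (simp add: vec_eq_iff matrix_matrix_mult_def mat_def sum_2 forall_2 varM_mult_varM_inv)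
qed


text \<open>The sequence \<open>(e\<^sub>n, \<dots>, e\<^sub>1, e\<^sub>1, \<dots>, e\<^sub>n)\<close>; the value \<open>e 0\<close> is never used.\<close>

definition sym_seq :: "(nat \<Rightarrow> int) \<Rightarrow> nat \<Rightarrow> int list"
  where "sym_seq e n = map e (rev [1..<Suc n]) @ map e [1..<Suc n]"

lemma symmetric_signs_sym_seq:
  assumes "\<And>i. i \<ge> 1 \<Longrightarrow> e i \<in> {- 1, 1}"
  shows "symmetric_signs (sym_seq e n)"
  using assms by (fastforce simp: symmetric_signs_def sym_seq_def rev_map)

end

theory Submission
  imports Defs
begin

text \<open>
  Write \<open>w\<^sub>n\<close> for the word of \<open>e(n)\<close> and \<open>v\<^sub>n\<close> for \<open>w\<^sub>n\<close> with \<open>x\<close> and \<open>y\<close> exchanged. Prepending a letter shifts the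
  parity of all positions, so \<open>w\<^sub>n\<^sub>+\<^sub>1 = x\<^sup>s v\<^sub>n y\<^sup>s\<close> and \<open>v\<^sub>n\<^sub>+\<^sub>1 = y\<^sup>s w\<^sub>n x\<^sup>s\<close> with \<open>s = e\<^sub>n\<^sub>+\<^sub>1\<close>. The matrix
  \<open>P = (z, 1; \<lambda>, -z)\<close> intertwines the exchange of the two generators. For \<open>n \<ge> 1\<close>
  the matrix of \<open>w\<^sub>n\<close> has the form \<open>(a, b; \<lambda> b, d)\<close>, with \<open>f\<^sub>n = a - z b\<close> and
  \<open>f\<^sub>n\<^sub>-\<^sub>1 = d + z b\<close>. Hence \<open>(f\<^sub>n, f\<^sub>n\<^sub>-\<^sub>1, (\<lambda> + z\<^sup>2) b)\<close> evolves by a linear recursion, and eliminating the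
  third coordinate gives the recurrence.
\<close>

section \<open>Two-by-two matrices and the matrices of the letters\<close>

abbreviation mat22 :: "'a \<Rightarrow> 'a \<Rightarrow> 'a \<Rightarrow> 'a \<Rightarrow> 'a::zero^2^2"
  where "mat22 a b c d \<equiv> vector [vector [a, b], vector [c, d]]"

lemma mat22_mult:
  "mat22 a b c d ** mat22 a' b' c' d' =
    (mat22 (a * a' + b * c') (a * b' + b * d') (c * a' + d * c') (c * b' + d * d')
      :: 'a::comm_ring_1^2^2)"
  by (simp add: vec_eq_iff matrix_matrix_mult_def sum_2 forall_2)

lemma mat22_eq_iff:
  "mat22 a b c d = mat22 a' b' c' d' \<longleftrightarrow> a = a' \<and> b = b' \<and> c = c' \<and> d = d'"
  by (auto simp: vec_eq_iff forall_2)

lemma mat22_exhaust: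
  obtains a b c d where "A = mat22 a b c d"
proof
  show "A = mat22 (A $ 1 $ 1) (A $ 1 $ 2) (A $ 2 $ 1) (A $ 2 $ 2)"
    by (simp add: vec_eq_iff forall_2)
qed

lemma mat_1_eq_mat22: "mat 1 = mat22 1 0 0 1"
  by (simp add: vec_eq_iff mat_def forall_2)

lemma matrix_inv_eqI:
  fixes A B :: "'a::comm_ring_1^'n^'n"
  assumes "A ** B = mat 1" "B ** A = mat 1"
  shows "matrix_inv A = B"
proof -
  have "A ** matrix_inv A = mat 1 \<and> matrix_inv A ** A = mat 1"
    unfolding matrix_inv_def by (rule someI) (use assms in blast)
  then have "matrix_inv A = matrix_inv A ** (A ** B)" "(matrix_inv A ** A) ** B = B"
    using assms by simp_all
  then show ?thesis
    by (simp add: matrix_mul_assoc)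
qed

text \<open>With \<open>powM s\<close> and \<open>powM (- s)\<close> a single formula covers a
  letter and its inverse.\<close>

definition powM :: "int \<Rightarrow> laurent_ring"
  where "powM s = [:Poly_Mapping.single s 1:]"

lemma powM_mult_uminus: "powM s * powM (- s) = 1"
  by (simp add: powM_def mult_single)

text \<open>Both generator matrices have determinant 1, so inversion exchanges the diagonal entries
  and negates the off-diagonal one, which therefore carries the factor \<open>s\<close>.\<close>

lemma letter_matrix_eq:
  assumes "s \<in> {- 1, 1}"
  shows "letter_matrix (Gen_x, s) = mat22 (powM s) (of_int s) 0 (powM (- s))"
    and "letter_matrix (Gen_y, s) = mat22 (powM s) 0 (of_int s * var_lambda) (powM (- s))"
proof -
  have "matrix_inv (gen_matrix Gen_x) = mat22 varM_inv (- 1) 0 varM"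
    by (rule matrix_inv_eqI)
      (simp_all add: mat_1_eq_mat22 mat22_mult mat22_eq_iff varM_mult_varM_inv)
  then show "letter_matrix (Gen_x, s) = mat22 (powM s) (of_int s) 0 (powM (- s))"
    using assms by (auto simp: powM_def varM_def varM_inv_def)
  have "matrix_inv (gen_matrix Gen_y) = mat22 varM_inv 0 (- var_lambda) varM"
    by (rule matrix_inv_eqI)
      (simp_all add: mat_1_eq_mat22 mat22_mult mat22_eq_iff varM_mult_varM_inv)
  then show "letter_matrix (Gen_y, s) = mat22 (powM s) 0 (of_int s * var_lambda) (powM (- s))"
    using assms by (auto simp: powM_def varM_def varM_inv_def)
qed

lemma var_z_eq:
  assumes "s \<in> {- 1, 1}"
  shows "var_z = of_int s * (powM s - powM (- s))"
  using assms by (auto simp: var_z_def powM_def varM_def varM_inv_def)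

section \<open>Words and the exchange of the generators\<close>

fun swap_gen :: "generator \<times> int \<Rightarrow> generator \<times> int"
  where
    "swap_gen (Gen_x, s) = (Gen_y, s)"
  | "swap_gen (Gen_y, s) = (Gen_x, s)"

lemma word_matrix_Cons: "word_matrix (a # u) = letter_matrix a ** word_matrix u"
  by (simp add: word_matrix_def)

lemma word_matrix_append: "word_matrix (u @ v) = word_matrix u ** word_matrix v"
  by (induction u) (simp_all add: word_matrix_def matrix_mul_assoc)

abbreviation swap_matrix :: "laurent_ring^2^2"
  where "swap_matrix \<equiv> mat22 var_z 1 var_lambda (- var_z)"

text \<open>Stated as intertwining, not conjugation: \<open>swap_matrix\<close> has determinant
  \<open>- lambda_tilde\<close>, which is not a unit.\<close>

lemma letter_matrix_swap_gen:
  assumes "snd a \<in> {- 1, 1}"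
  shows "letter_matrix (swap_gen a) ** swap_matrix = swap_matrix ** letter_matrix a"
proof (cases a)
  case (Pair g s)
  then have s: "s \<in> {- 1, 1}"
    using assms by simp
  show ?thesis
    using s unfolding Pair
    by (cases g) (auto simp: letter_matrix_eq[OF s] mat22_mult mat22_eq_iff var_z_eq[OF s]
        algebra_simps simp del: letter_matrix.simps)
qed

lemma word_matrix_swap_gen:
  assumes "\<forall>a\<in>set u. snd a \<in> {- 1, 1}"
  shows "word_matrix (map swap_gen u) ** swap_matrix = swap_matrix ** word_matrix u"
  using assms
proof (induction u)
  case Nil
  then show ?case by (simp add: word_matrix_def)
next
  case (Cons a u)
  then have "word_matrix (map swap_gen (a # u)) ** swap_matrix
      = letter_matrix (swap_gen a) ** swap_matrix ** word_matrix u"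
    by (simp add: word_matrix_Cons flip: matrix_mul_assoc)
  also have "\<dots> = swap_matrix ** word_matrix (a # u)"
    using Cons.prems by (simp add: letter_matrix_swap_gen word_matrix_Cons matrix_mul_assoc)
  finally show ?case .
qed

lemma swap_gen_swap_gen: "swap_gen (swap_gen a) = a"
  by (cases a rule: swap_gen.cases) simp_all

lemma length_sym_seq: "length (sym_seq e n) = 2 * n"
  by (simp add: sym_seq_def)

lemma sym_seq_Suc: "sym_seq e (Suc n) = e (Suc n) # sym_seq e n @ [e (Suc n)]"
  by (simp add: sym_seq_def)

lemma nth_kmot_word:
  "i < length eps \<Longrightarrow> kmot_word eps ! i = (if even i then Gen_x else Gen_y, eps ! i)"
  by (simp add: kmot_word_def)

lemma length_kmot_word: "length (kmot_word eps) = length eps"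
  by (simp add: kmot_word_def)

lemma kmot_word_sym_seq_Suc:
  "kmot_word (sym_seq e (Suc n)) =
    (Gen_x, e (Suc n)) # map swap_gen (kmot_word (sym_seq e n)) @ [(Gen_y, e (Suc n))]"
proof (rule nth_equalityI)
  show "length (kmot_word (sym_seq e (Suc n))) =
      length ((Gen_x, e (Suc n)) # map swap_gen (kmot_word (sym_seq e n)) @ [(Gen_y, e (Suc n))])"
    by (simp add: length_kmot_word length_sym_seq)
next
  fix i
  assume "i < length (kmot_word (sym_seq e (Suc n)))"
  then have "i < 2 * n + 2"
    by (simp add: length_kmot_word length_sym_seq)
  \<comment> \<open>The last position \<open>2 * n + 1\<close> is odd, so the appended letter is a
    power of y.\<close>
  then consider "i = 0" | j where "i = Suc j" "j < 2 * n" | "i = Suc (2 * n)"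
    by (cases i) (auto simp: less_Suc_eq)
  then show "kmot_word (sym_seq e (Suc n)) ! i =
      ((Gen_x, e (Suc n)) # map swap_gen (kmot_word (sym_seq e n)) @ [(Gen_y, e (Suc n))]) ! i"
    by cases (simp_all add: nth_kmot_word length_kmot_word length_sym_seq sym_seq_Suc nth_append)
qed

section \<open>The linear recursion and its elimination\<close>

locale sign_sequence =
  fixes e :: "nat \<Rightarrow> int"
  assumes signs: "i \<ge> 1 \<Longrightarrow> e i \<in> {- 1, 1}"
begin

definition W :: "nat \<Rightarrow> laurent_ring^2^2"
  where "W n = word_matrix (kmot_word (sym_seq e n))"

definition S :: "nat \<Rightarrow> laurent_ring^2^2"
  where "S n = word_matrix (map swap_gen (kmot_word (sym_seq e n)))"

lemma W_Suc: "W (Suc n) = letter_matrix (Gen_x, e (Suc n)) ** S n ** letter_matrix (Gen_y, e (Suc n))"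
  by (simp add: W_def S_def kmot_word_sym_seq_Suc word_matrix_Cons word_matrix_append
      matrix_mul_assoc del: letter_matrix.simps) (simp add: word_matrix_def)

lemma S_Suc: "S (Suc n) = letter_matrix (Gen_y, e (Suc n)) ** W n ** letter_matrix (Gen_x, e (Suc n))"
  by (simp add: W_def S_def kmot_word_sym_seq_Suc word_matrix_Cons word_matrix_append
      matrix_mul_assoc swap_gen_swap_gen comp_def del: letter_matrix.simps)
    (simp add: word_matrix_def)

lemma S_swap_matrix: "S n ** swap_matrix = swap_matrix ** W n"
  unfolding S_def W_def
proof (rule word_matrix_swap_gen)
  have "set (sym_seq e n) \<subseteq> {- 1, 1}"
    using signs by (fastforce simp: sym_seq_def)
  then show "\<forall>a\<in>set (kmot_word (sym_seq e n)). snd a \<in> {- 1, 1}"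
    by (force simp: kmot_word_def dest: nth_mem)
qed

text \<open>Both words are fixed by reversal followed by the exchange of x and y, which on matrices
  is transposition up to rescaling by \<lambda>. The induction is joint because each family steps to
  the other.\<close>

lemma lower_left:
  "W n $ 2 $ 1 = var_lambda * W n $ 1 $ 2 \<and> S n $ 2 $ 1 = var_lambda * S n $ 1 $ 2"
proof (induction n)
  case 0
  then show ?case
    by (simp add: W_def S_def kmot_word_def sym_seq_def word_matrix_def mat_def)
next
  case (Suc n)
  obtain a b c d where W: "W n = mat22 a b c d" by (rule mat22_exhaust)
  obtain p q r s where S: "S n = mat22 p q r s" by (rule mat22_exhaust)
  have "e (Suc n) \<in> {- 1, 1}" by (rule signs) simp
  from letter_matrix_eq[OF this] Suc show ?case
    by (simp add: W_Suc S_Suc W S mat22_mult algebra_simps del: letter_matrix.simps)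
qed

abbreviation riley :: "nat \<Rightarrow> laurent_ring"
  where "riley n \<equiv> riley_poly (sym_seq e n)"

lemma riley_eq: "riley n = W n $ 1 $ 1 - var_z * W n $ 1 $ 2"
  by (simp add: riley_poly_def W_def Let_def)

lemma riley_eq_S: "riley n = S n $ 2 $ 2 + var_z * S n $ 1 $ 2"
  and S_upper_right: "lambda_tilde * S n $ 1 $ 2 =
    var_z * (W n $ 1 $ 1 - W n $ 2 $ 2) + (var_lambda - var_z\<^sup>2) * W n $ 1 $ 2"
proof -
  obtain a b c d where W: "W n = mat22 a b c d" by (rule mat22_exhaust)
  obtain p q r s where S: "S n = mat22 p q r s" by (rule mat22_exhaust)
  have c: "c = var_lambda * b" and r: "r = var_lambda * q"
    using lower_left[of n] by (simp_all add: W S)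
  have eqs: "p * var_z + q * var_lambda = var_z * a + c" "p + q * - var_z = var_z * b + d"
    "r * var_z + s * var_lambda = var_lambda * a - var_z * c"
    using S_swap_matrix[of n] by (simp_all add: W S mat22_mult mat22_eq_iff)
  have "var_lambda * (s + var_z * q) = var_lambda * (a - var_z * b)"
    using eqs(3) by (simp add: c r algebra_simps)
  \<comment> \<open>\<lambda> can be cancelled, since multiplying a polynomial by the indeterminate
    only shifts its coefficients.\<close>
  then have "s + var_z * q = a - var_z * b"
    by (simp add: var_lambda_def)
  then show "riley n = S n $ 2 $ 2 + var_z * S n $ 1 $ 2"
    by (simp add: riley_eq W S)
  have p: "p = var_z * q + var_z * b + d"
    using eqs(2) by (simp add: algebra_simps)
  have "lambda_tilde * q = var_z * (a - d) + (var_lambda - var_z\<^sup>2) * b"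
    using eqs(1) unfolding p c lambda_tilde_def by algebra
  then show "lambda_tilde * S n $ 1 $ 2 =
      var_z * (W n $ 1 $ 1 - W n $ 2 $ 2) + (var_lambda - var_z\<^sup>2) * W n $ 1 $ 2"
    by (simp add: W S)
qed

text \<open>The coefficient of the lower right entry of \<open>S n\<close> collapses to M^(-2s) +
  (M^s - M^(-s)) M^(-s) = 1. Thus a single matrix \<open>W (Suc n)\<close> yields two consecutive
  Riley polynomials.\<close>

lemma riley_eq_W_Suc: "riley n = W (Suc n) $ 2 $ 2 + var_z * W (Suc n) $ 1 $ 2"
proof -
  define s where "s = e (Suc n)"
  have s: "s \<in> {- 1, 1}" unfolding s_def by (rule signs) simp
  obtain p q r t where S: "S n = mat22 p q r t" by (rule mat22_exhaust)
  have "of_int s * of_int s = (1 :: laurent_ring)" using s by auto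
  then have "powM (- s) * t * powM (- s) + var_z * ((powM s * q + of_int s * t) * powM (- s))
      = t + var_z * q"
    using powM_mult_uminus[of s] var_z_eq[OF s] by algebra
  then show ?thesis
    using letter_matrix_eq[OF s]
    by (simp add: riley_eq_S W_Suc S mat22_mult flip: s_def del: letter_matrix.simps)
qed

text \<open>Reading the left side from \<open>S (Suc (Suc n))\<close> instead of
  \<open>W (Suc (Suc n))\<close> involves only entries of \<open>W (Suc n)\<close>.\<close>

lemma riley_Suc_Suc:
  fixes n
  defines "s \<equiv> e (Suc (Suc n))"
  shows "riley (Suc (Suc n)) =
    (powM s ^ 2 - 1 + var_lambda) * riley (Suc n) + powM (- s) ^ 2 * riley n
      + of_int s * (varM + varM_inv) * (lambda_tilde * W (Suc n) $ 1 $ 2)"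
proof -
  have s: "s \<in> {- 1, 1}" unfolding s_def by (rule signs) simp
  obtain a b c d where W: "W (Suc n) = mat22 a b c d" by (rule mat22_exhaust)
  have c: "c = var_lambda * b"
    using lower_left[of "Suc n"] by (simp add: W)
  have ss: "of_int s * of_int s = (1 :: laurent_ring)" using s by auto
  have sum: "varM + varM_inv = powM s + powM (- s)"
    using s by (auto simp: powM_def varM_def varM_inv_def)
  have "(of_int s * var_lambda * a + powM (- s) * c) * of_int s
        + (of_int s * var_lambda * b + powM (- s) * d) * powM (- s)
        + var_z * (powM s * a * of_int s + powM s * b * powM (- s)) =
      (powM s ^ 2 - 1 + var_lambda) * (a - var_z * b) + powM (- s) ^ 2 * (d + var_z * b)
        + of_int s * (powM s + powM (- s)) * ((var_lambda + var_z\<^sup>2) * b)"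
    using powM_mult_uminus[of s] var_z_eq[OF s] ss c by algebra
  then show ?thesis
    using letter_matrix_eq[OF s]
    by (simp add: riley_eq_S[of "Suc (Suc n)"] riley_eq[of "Suc n"] riley_eq_W_Suc[of n] S_Suc[of "Suc n"]
        W mat22_mult sum lambda_tilde_def flip: s_def del: letter_matrix.simps)
qed

text \<open>The factor \<open>lambda_tilde\<close> is kept because \<open>S_upper_right\<close>
  gives the entry of \<open>S (Suc n)\<close> needed here only after multiplication by it.\<close>

lemma W_upper_right_Suc:
  fixes n
  defines "s \<equiv> e (Suc (Suc n))"
  shows "lambda_tilde * W (Suc (Suc n)) $ 1 $ 2 =
    powM (- s) ^ 2 * (lambda_tilde * W (Suc n) $ 1 $ 2 + var_z * (riley (Suc n) - riley n))
      + of_int s * powM (- s) * lambda_tilde * riley (Suc n)"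
proof -
  have s: "s \<in> {- 1, 1}" unfolding s_def by (rule signs) simp
  obtain a b c d where W: "W (Suc n) = mat22 a b c d" by (rule mat22_exhaust)
  obtain p q r t where S: "S (Suc n) = mat22 p q r t" by (rule mat22_exhaust)
  have ss: "of_int s * of_int s = (1 :: laurent_ring)" using s by auto
  have t: "a - var_z * b = t + var_z * q"
    using riley_eq[of "Suc n"] riley_eq_S[of "Suc n"] by (simp add: W S)
  have q: "lambda_tilde * q = var_z * (a - d) + (var_lambda - var_z\<^sup>2) * b"
    using S_upper_right[of "Suc n"] by (simp add: W S)
  have "lambda_tilde * ((powM s * q + of_int s * t) * powM (- s)) =
      powM (- s) ^ 2 * (lambda_tilde * b + var_z * ((a - var_z * b) - (d + var_z * b)))
        + of_int s * powM (- s) * lambda_tilde * (a - var_z * b)"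
    using powM_mult_uminus[of s] var_z_eq[OF s] ss t q lambda_tilde_def by algebra
  then show ?thesis
    using letter_matrix_eq[OF s]
    by (simp add: riley_eq[of "Suc n"] riley_eq_W_Suc[of n] W_Suc[of "Suc n"] S W mat22_mult
        flip: s_def del: letter_matrix.simps)
qed

lemma riley_recurrence:
  fixes n
  defines "\<delta> \<equiv> e (Suc (Suc n)) * e (Suc (Suc (Suc n)))"
  shows "\<delta> = 1 \<Longrightarrow> riley (Suc (Suc (Suc n))) =
      (lambda_tilde + 1) * (riley (Suc (Suc n)) + riley (Suc n)) - riley n"
    and "\<delta> = - 1 \<Longrightarrow> riley (Suc (Suc (Suc n))) =
      (var_lambda - 1) * (riley (Suc (Suc n)) - riley (Suc n)) + riley n"
proof -
  define s where "s = e (Suc (Suc n))"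
  define t where "t = e (Suc (Suc (Suc n)))"
  have s: "s \<in> {- 1, 1}" unfolding s_def by (rule signs) simp
  have t: "t \<in> {- 1, 1}" unfolding t_def by (rule signs) simp
  have ss: "of_int s * of_int s = (1 :: laurent_ring)" using s by auto
  have sum: "varM + varM_inv = powM s + powM (- s)"
    using s by (auto simp: powM_def varM_def varM_inv_def)
  note r = riley_Suc_Suc[of n, folded s_def, unfolded sum]
    riley_Suc_Suc[of "Suc n", folded t_def, unfolded sum]
    W_upper_right_Suc[of n, folded s_def]
  define N m where "N = powM s" and "m = powM (- s)"
  have Nm: "N * m = 1"
    unfolding N_def m_def by (rule powM_mult_uminus)
  have z: "var_z = of_int s * (N - m)"
    unfolding N_def m_def by (rule var_z_eq[OF s])
  have z2: "var_z\<^sup>2 = N\<^sup>2 + m\<^sup>2 - 2"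
    using Nm ss unfolding z by algebra
  \<comment> \<open>The coefficient of the third coordinate in \<open>riley_Suc_Suc\<close>.\<close>
  define T where "T = of_int s * (N + m)"
  have Tz: "T * var_z = N\<^sup>2 - m\<^sup>2"
    using ss unfolding T_def z by algebra
  have Ts: "T * of_int s = N + m"
    using ss unfolding T_def by algebra
  define F0 F1 F2 B where "F0 = riley n" and "F1 = riley (Suc n)" and "F2 = riley (Suc (Suc n))"
    and "B = lambda_tilde * W (Suc n) $ 1 $ 2"
  have TB: "T * B = F2 - (N\<^sup>2 - 1 + var_lambda) * F1 - m\<^sup>2 * F0"
    using r(1) by (simp add: N_def m_def T_def F0_def F1_def F2_def B_def algebra_simps)
  \<comment> \<open>After multiplication by \<open>T\<close>, \<open>B\<close> enters only through
    \<open>T * B\<close>, which \<open>TB\<close> expresses by Riley polynomials; no division by M +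
    M^(-1) is needed.\<close>
  have "T * (lambda_tilde * W (Suc (Suc n)) $ 1 $ 2)
      = m\<^sup>2 * (T * B + T * var_z * (F1 - F0)) + T * of_int s * m * lambda_tilde * F1"
    unfolding r(3) by (simp add: N_def m_def F0_def F1_def B_def algebra_simps)
  note TB' = this[unfolded TB Tz Ts]
  show "riley (Suc (Suc (Suc n))) =
      (lambda_tilde + 1) * (riley (Suc (Suc n)) + riley (Suc n)) - riley n" if "\<delta> = 1"
  proof -
    have "t = s" using that s t by (auto simp: \<delta>_def s_def t_def)
    with r(2) have "riley (Suc (Suc (Suc n))) = (N\<^sup>2 - 1 + var_lambda) * F2 + m\<^sup>2 * F1
        + T * (lambda_tilde * W (Suc (Suc n)) $ 1 $ 2)"
      by (simp add: N_def m_def T_def F1_def F2_def)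
    also have "\<dots> = (lambda_tilde + 1) * (F2 + F1) - F0"
      unfolding TB' unfolding lambda_tilde_def z2 using Nm by algebra
    finally show ?thesis
      by (simp add: F0_def F1_def F2_def)
  qed
  show "riley (Suc (Suc (Suc n))) =
      (var_lambda - 1) * (riley (Suc (Suc n)) - riley (Suc n)) + riley n" if "\<delta> = - 1"
  proof -
    \<comment> \<open>Changing the sign exchanges \<open>N\<close> and \<open>m\<close> and turns
      the coefficient \<open>T\<close> into \<open>- T\<close>.\<close>
    have "t = - s" using that s t by (auto simp: \<delta>_def s_def t_def)
    with r(2) have "riley (Suc (Suc (Suc n))) = (m\<^sup>2 - 1 + var_lambda) * F2 + N\<^sup>2 * F1
        - T * (lambda_tilde * W (Suc (Suc n)) $ 1 $ 2)"
      by (simp add: N_def m_def T_def F1_def F2_def)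
    also have "\<dots> = (var_lambda - 1) * (F2 - F1) + F0"
      unfolding TB' unfolding lambda_tilde_def z2 using Nm by algebra
    finally show ?thesis
      by (simp add: F0_def F1_def F2_def)
  qed
qed

end


theorem corollary6p6:
  fixes e :: "nat \<Rightarrow> int"
    and f :: "nat \<Rightarrow> laurent_ring"
    and \<delta> :: "nat \<Rightarrow> int"
    and n :: nat
  assumes e: "\<And>i. i \<ge> 1 \<Longrightarrow> e i \<in> {- 1, 1}"
    and f_0: "f 0 = 1"
    and f: "\<And>m. m \<ge> 1 \<Longrightarrow> f m = riley_poly (sym_seq e m)"
    and \<delta>: "\<And>m. m \<ge> 2 \<Longrightarrow> \<delta> m = e (m - 1) * e m"
    and n: "n > 2"
  shows "(\<delta> n = 1 \<longrightarrow>
        f n = (lambda_tilde + 1) * (f (n - 1) + f (n - 2)) - f (n - 3))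
    \<and> (\<delta> n = - 1 \<longrightarrow>
        f n = (var_lambda - 1) * (f (n - 1) - f (n - 2)) + f (n - 3))
    \<and> f n =
      (lambda_tilde + of_int ((\<delta> n - 1) div 2) * var_z\<^sup>2 + of_int (\<delta> n))
        * (f (n - 1) + of_int (\<delta> n) * f (n - 2)) - of_int (\<delta> n) * f (n - 3)"
proof -
  interpret sign_sequence e
    using e by unfold_locales
  \<comment> \<open>The empty word has the identity matrix, so the convention for \<open>f 0\<close>
    fits the general formula and the recurrence may start at index 0.\<close>
  have "riley 0 = 1"
    by (simp add: riley_poly_def kmot_word_def sym_seq_def word_matrix_def mat_def)
  then have f_eq: "f m = riley m" for m
    using f_0 f by (cases m) auto
  obtain k where k: "n = Suc (Suc (Suc k))"
    using n by (metis add_2_eq_Suc less_imp_Suc_add)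
  have \<delta>_eq: "\<delta> n = e (Suc (Suc k)) * e (Suc (Suc (Suc k)))"
    using \<delta>[of n] by (simp add: k)
  then have "\<delta> n = 1 \<or> \<delta> n = - 1"
    using e[of "Suc (Suc k)"] e[of "Suc (Suc (Suc k))"] by auto
  \<comment> \<open>For \<open>\<delta> n = - 1\<close> the integer quotient is exactly -1, and the
    z^2 in \<open>lambda_tilde\<close> cancels.\<close>
  then show ?thesis
    using riley_recurrence[of k, folded \<delta>_eq]
    by (auto simp: f_eq k lambda_tilde_def)
qed

end
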